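(* Let $X$ be a non-empty compact locally connected dense-in-itself metric space, and let $\mathcal L\subseteq\mathcal L^{\mu\langle t\rangle\langle dt\rangle}_{\Box[d]\forall}$ be a language containing $\mathcal L_{\Box\forall}$ or $\mathcal L_{[d]\forall}$. Then no Hilbert system for $\mathcal L$ is sound and strongly complete over $X$.
   Context: A metric space is regarded as a topological space with its metric topology. A space is dense in itself if no singleton subset is open; compact if every open cover has a finite subcover; locally connected if every open neighbourhood of a point $x$ contains a connected open neighbourhood of $x$. $\mathrm{cl}$ is closure, and $\langle d\rangle S=\{x: S\cap O\setminus\{x\}\neq\emptyset\text{ for every open neighbourhood }O\text{ of }x\}$ for $S\subseteq X$. LANGUAGES. $\mathsf{Var}$ is an infinite set of propositional variables (atoms). $\mathcal L^{\mu\langle t\rangle\langle dt\rangle}_{\Box[d]\forall}$-formulas: atoms; $\top$; $\neg\varphi$; $\varphi\wedge\psi$; $\Box\varphi$; $[d]\varphi$; $\forall\varphi$; $\langle t\rangle\Delta$ and $\langle dt\rangle\Delta$ for non-empty finite sets $\Delta$ of formulas; and $\mu q\varphi$ where $q\in\mathsf{Var}$ and $\varphi$ is positive in $q$ (every free occurrence of $q$ lies under an even number of negations; $\mu q$ binds $q$). The (sub)languages considered are obtained by omitting some of the operators $\Box,[d],\forall,\langle t\rangle,\langle dt\rangle,\mu$ and consist of all formulas not involving the omitted operators; the notation lists the permitted operators, so $\mathcal L_{\Box\forall}$ permits just $\Box$ and $\forall$, and $\mathcal L_{[d]\forall}$ just $[d]$ and $\forall$ (besides atoms, $\top$ and Booleans).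 SEMANTICS. An assignment into $X$ is a map $h:\mathsf{Var}\to\wp(X)$; $[\![\varphi]\!]_h=\{x\in X:(X,h),x\models\varphi\}$. An atom $p$ is true at $x$ iff $x\in h(p)$; $\top$ and Booleans as usual; $\Box\varphi$ is true at $x$ iff some open neighbourhood $O$ of $x$ has $\varphi$ true at every $y\in O$; $[d]\varphi$ is true at $x$ iff some open neighbourhood $O$ of $x$ has $\varphi$ true at every $y\in O\setminus\{x\}$; $\forall\varphi$ is true at $x$ iff $\varphi$ is true at every $y\in X$; $\langle t\rangle\Delta$ (respectively $\langle dt\rangle\Delta$) is true at $x$ iff there is $S\subseteq X$ with $x\in S\subseteq\bigcap_{\delta\in\Delta}\mathrm{cl}([\![\delta]\!]_h\cap S)$ (respectively $x\in S\subseteq\bigcap_{\delta\in\Delta}\langle d\rangle([\![\delta]\!]_h\cap S)$); $\mu q\varphi$ is true at $x$ iff $x$ is in the least fixed point of the monotonic map $S\mapsto[\![\varphi]\!]_{h[S/q]}$, where $h[S/q]$ agrees with $h$ except that it sends $q$ to $S$. A formula is valid in $X$ if true at every point under every assignment; a set of formulas is satisfiable in $X$ if all its members are true at one point under one assignment. HILBERT SYSTEMS. A Hilbert system $H$ for $\mathcal L$ is a set of axioms ($\mathcal L$-formulas) together with a set of inference rules, each with instances of the form: from finitely many $\mathcal L$-formulas $\varphi_1,\dots,\varphi_n$ infer an $\mathcal L$-formula $\psi$. A derivation is a finite sequence of $\mathcal L$-formulas each of which is an axiom or follows from earlier ones by a rule; a theorem is a formula occurring in a derivation. $H$ is sound over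 $X$ if all theorems are valid in $X$. A formula is $H$-consistent if its negation is not a theorem; a set is $H$-consistent if the conjunction of each finite subset is. $H$ is strongly complete over $X$ if every countable $H$-consistent set of $\mathcal L$-formulas is satisfiable in $X$. *)

theory Defs
  imports "HOL-Analysis.Analysis" "HOL-Library.FSet" "HOL-Library.Countable_Set"
begin

datatype 'v fm =
    Atom 'v
  | Top
  | Neg "'v fm"
  | And "'v fm" "'v fm"
  | Box "'v fm"
  | DBox "'v fm"
  | All "'v fm"
  | Tangle "'v fm fset"
  | DTangle "'v fm fset"
  | Mu 'v "'v fm"

lemma size_fset_mem [termination_simp]:
  "\<delta> |\<in>| \<Delta> \<Longrightarrow> size \<delta> < Suc (\<Sum>x\<in>fset \<Delta>. Suc (size x))"
  using member_le_sum[of \<delta> "fset \<Delta>" "\<lambda>x. Suc (size x)"] by simp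

(* "parity True q \<phi>" ("parity False q \<phi>"): every free occurrence of q in \<phi> lies under
   an even (odd) number of negations. *)
fun parity :: "bool \<Rightarrow> 'v \<Rightarrow> 'v fm \<Rightarrow> bool" where
  "parity b q (Atom p) \<longleftrightarrow> (p = q \<longrightarrow> b)"
| "parity b q Top \<longleftrightarrow> True"
| "parity b q (Neg \<phi>) \<longleftrightarrow> parity (\<not> b) q \<phi>"
| "parity b q (And \<phi> \<psi>) \<longleftrightarrow> parity b q \<phi> \<and> parity b q \<psi>"
| "parity b q (Box \<phi>) \<longleftrightarrow> parity b q \<phi>"
| "parity b q (DBox \<phi>) \<longleftrightarrow> parity b q \<phi>"
| "parity b q (All \<phi>) \<longleftrightarrow> parity b q \<phi>"
| "parity b q (Tangle \<Delta>) \<longleftrightarrow> fBall \<Delta> (\<lambda>\<delta>. parity b q \<delta>)"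
| "parity b q (DTangle \<Delta>) \<longleftrightarrow> fBall \<Delta> (\<lambda>\<delta>. parity b q \<delta>)"
| "parity b q (Mu p \<phi>) \<longleftrightarrow> p = q \<or> parity b q \<phi>"

abbreviation positive :: "'v \<Rightarrow> 'v fm \<Rightarrow> bool" where
  "positive \<equiv> parity True"

(* The side conditions that the datatype does not enforce. *)
fun wff :: "'v fm \<Rightarrow> bool" where
  "wff (Atom p) \<longleftrightarrow> True"
| "wff Top \<longleftrightarrow> True"
| "wff (Neg \<phi>) \<longleftrightarrow> wff \<phi>"
| "wff (And \<phi> \<psi>) \<longleftrightarrow> wff \<phi> \<and> wff \<psi>"
| "wff (Box \<phi>) \<longleftrightarrow> wff \<phi>"
| "wff (DBox \<phi>) \<longleftrightarrow> wff \<phi>"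
| "wff (All \<phi>) \<longleftrightarrow> wff \<phi>"
| "wff (Tangle \<Delta>) \<longleftrightarrow> \<Delta> \<noteq> {||} \<and> fBall \<Delta> (\<lambda>\<delta>. wff \<delta>)"
| "wff (DTangle \<Delta>) \<longleftrightarrow> \<Delta> \<noteq> {||} \<and> fBall \<Delta> (\<lambda>\<delta>. wff \<delta>)"
| "wff (Mu q \<phi>) \<longleftrightarrow> positive q \<phi> \<and> wff \<phi>"

datatype operator = OBox | ODBox | OAll | OTangle | ODTangle | OMu

fun operators :: "'v fm \<Rightarrow> operator set" where
  "operators (Atom p) = {}"
| "operators Top = {}"
| "operators (Neg \<phi>) = operators \<phi>"
| "operators (And \<phi> \<psi>) = operators \<phi> \<union> operators \<psi>"
| "operators (Box \<phi>) = insert OBox (operators \<phi>)"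
| "operators (DBox \<phi>) = insert ODBox (operators \<phi>)"
| "operators (All \<phi>) = insert OAll (operators \<phi>)"
| "operators (Tangle \<Delta>) = insert OTangle (\<Union>\<delta>\<in>fset \<Delta>. operators \<delta>)"
| "operators (DTangle \<Delta>) = insert ODTangle (\<Union>\<delta>\<in>fset \<Delta>. operators \<delta>)"
| "operators (Mu q \<phi>) = insert OMu (operators \<phi>)"

definition language :: "operator set \<Rightarrow> 'v fm set" where
  "language Ops = {\<phi>. wff \<phi> \<and> operators \<phi> \<subseteq> Ops}"

definition assignment :: "'a topology \<Rightarrow> ('v \<Rightarrow> 'a set) \<Rightarrow> bool" where
  "assignment X h \<longleftrightarrow> (\<forall>p. h p \<subseteq> topspace X)"

(* For Mu, LEAST is with respect to inclusion of sets: it denotes the least fixed point of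
   the map on the powerset of X, which exists by Knaster-Tarski for well-formed formulas. *)
fun sat :: "'a topology \<Rightarrow> ('v \<Rightarrow> 'a set) \<Rightarrow> 'a \<Rightarrow> 'v fm \<Rightarrow> bool" where
  "sat X h x (Atom p) \<longleftrightarrow> x \<in> h p"
| "sat X h x Top \<longleftrightarrow> True"
| "sat X h x (Neg \<phi>) \<longleftrightarrow> \<not> sat X h x \<phi>"
| "sat X h x (And \<phi> \<psi>) \<longleftrightarrow> sat X h x \<phi> \<and> sat X h x \<psi>"
| "sat X h x (Box \<phi>) \<longleftrightarrow> (\<exists>U. openin X U \<and> x \<in> U \<and> (\<forall>y\<in>U. sat X h y \<phi>))"
| "sat X h x (DBox \<phi>) \<longleftrightarrow> (\<exists>U. openin X U \<and> x \<in> U \<and> (\<forall>y\<in>U - {x}. sat X h y \<phi>))"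
| "sat X h x (All \<phi>) \<longleftrightarrow> (\<forall>y\<in>topspace X. sat X h y \<phi>)"
| "sat X h x (Tangle \<Delta>) \<longleftrightarrow> (\<exists>S\<subseteq>topspace X. x \<in> S \<and>
     S \<subseteq> (\<Inter>\<delta>\<in>fset \<Delta>. X closure_of ({y \<in> topspace X. sat X h y \<delta>} \<inter> S)))"
| "sat X h x (DTangle \<Delta>) \<longleftrightarrow> (\<exists>S\<subseteq>topspace X. x \<in> S \<and>
     S \<subseteq> (\<Inter>\<delta>\<in>fset \<Delta>. X derived_set_of ({y \<in> topspace X. sat X h y \<delta>} \<inter> S)))"
| "sat X h x (Mu q \<phi>) \<longleftrightarrow>
     x \<in> (LEAST S. S \<subseteq> topspace X \<and> {y \<in> topspace X. sat X (h(q := S)) y \<phi>} = S)"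

definition valid_in :: "'a topology \<Rightarrow> 'v fm \<Rightarrow> bool" where
  "valid_in X \<phi> \<longleftrightarrow> (\<forall>h. assignment X h \<longrightarrow> (\<forall>x\<in>topspace X. sat X h x \<phi>))"

definition satisfiable_in :: "'a topology \<Rightarrow> 'v fm set \<Rightarrow> bool" where
  "satisfiable_in X \<Gamma> \<longleftrightarrow> (\<exists>h. assignment X h \<and> (\<exists>x\<in>topspace X. \<forall>\<phi>\<in>\<Gamma>. sat X h x \<phi>))"

(* An inference rule is identified with the set of its instances (premises, conclusion). *)
record 'v hilbert =
  axs :: "'v fm set"
  inference_rules :: "('v fm list \<times> 'v fm) set set"

definition hilbert_system :: "'v fm set \<Rightarrow> 'v hilbert \<Rightarrow> bool" where
  "hilbert_system L H \<longleftrightarrow> axs H \<subseteq> L \<and>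
     (\<forall>R\<in>inference_rules H. \<forall>(\<phi>s, \<psi>)\<in>R. set \<phi>s \<subseteq> L \<and> \<psi> \<in> L)"

definition derivation :: "'v fm set \<Rightarrow> 'v hilbert \<Rightarrow> 'v fm list \<Rightarrow> bool" where
  "derivation L H ds \<longleftrightarrow> set ds \<subseteq> L \<and>
     (\<forall>i<length ds. ds ! i \<in> axs H \<or>
        (\<exists>R\<in>inference_rules H. \<exists>\<phi>s. (\<phi>s, ds ! i) \<in> R \<and> set \<phi>s \<subseteq> set (take i ds)))"

definition hilbert_theorem :: "'v fm set \<Rightarrow> 'v hilbert \<Rightarrow> 'v fm \<Rightarrow> bool" where
  "hilbert_theorem L H \<phi> \<longleftrightarrow> (\<exists>ds. derivation L H ds \<and> \<phi> \<in> set ds)"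

definition sound_over :: "'v fm set \<Rightarrow> 'v hilbert \<Rightarrow> 'a topology \<Rightarrow> bool" where
  "sound_over L H X \<longleftrightarrow> (\<forall>\<phi>. hilbert_theorem L H \<phi> \<longrightarrow> valid_in X \<phi>)"

definition consistent :: "'v fm set \<Rightarrow> 'v hilbert \<Rightarrow> 'v fm \<Rightarrow> bool" where
  "consistent L H \<phi> \<longleftrightarrow> \<not> hilbert_theorem L H (Neg \<phi>)"

(* "conjunction_of A \<phi>": \<phi> is a conjunction of the formulas in the finite set A, in some order
   and bracketing.  A Hilbert system need not identify different such conjunctions up to
   provable equivalence, so no particular one is singled out. *)
inductive conjunction_of :: "'v fm set \<Rightarrow> 'v fm \<Rightarrow> bool" where
  "conjunction_of {} Top"
| "conjunction_of {\<phi>} \<phi>"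
| "conjunction_of A \<phi> \<Longrightarrow> conjunction_of B \<psi> \<Longrightarrow> conjunction_of (A \<union> B) (And \<phi> \<psi>)"

(* Requiring every conjunction to be consistent gives the strongest notion of consistent set,
   hence the weakest notion of strong completeness; a non-completeness result for it applies
   to any fixed choice of conjunctions. *)
definition consistent_set :: "'v fm set \<Rightarrow> 'v hilbert \<Rightarrow> 'v fm set \<Rightarrow> bool" where
  "consistent_set L H \<Gamma> \<longleftrightarrow>
     (\<forall>A \<phi>. finite A \<and> A \<subseteq> \<Gamma> \<and> conjunction_of A \<phi> \<longrightarrow> consistent L H \<phi>)"

definition strongly_complete_over :: "'v fm set \<Rightarrow> 'v hilbert \<Rightarrow> 'a topology \<Rightarrow> bool" where
  "strongly_complete_over L H X \<longleftrightarrow>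
     (\<forall>\<Gamma>\<subseteq>L. countable \<Gamma> \<and> consistent_set L H \<Gamma> \<longrightarrow> satisfiable_in X \<Gamma>)"

definition dense_in_itself :: "'a topology \<Rightarrow> bool" where
  "dense_in_itself X \<longleftrightarrow> (\<forall>x\<in>topspace X. \<not> openin X {x})"

end

theory Submission
  imports Defs
begin

text \<open>
  A sound and strongly complete Hilbert system forces semantic compactness: a countable set
  of formulas, each finite part of which is satisfiable in \<open>X\<close>, is itself satisfiable,
  because by soundness it is consistent.  So it suffices to exhibit formulas violating
  semantic compactness that use only an interior operator and the universal modality.

  They speak of two sets \<open>F\<close> and \<open>G\<close> with disjoint closures and an increasing sequence of
  sets \<open>V n\<close>, each having its frontier inside \<open>G\<close> and each of the differences
  \<open>V (n + 1) - V n\<close> containing a point of \<open>F\<close>; thus \<open>G\<close> is a system of fences separating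
  infinitely many points of \<open>F\<close> from one another.  Local connectedness covers \<open>X\<close> by
  connected sets missing \<open>F\<close> or \<open>G\<close>, and compactness makes finitely many suffice.
  One of them contains two of the separated points, so it has to cross a fence, although it
  meets \<open>F\<close> and hence misses \<open>G\<close> (\<open>infinitely_many_fences_impossible\<close>).  Any finite number of
  fences, however, can be put up in every infinite Hausdorff space: surround finitely many
  points by disjoint open sets and let \<open>G\<close> be everything outside these
  (\<open>finitely_many_fences_exist\<close>).  A non-empty dense-in-itself metric space is infinite.
\<close>

section \<open>Fences in a topological space\<close>

definition fence :: "'a topology \<Rightarrow> 'a set \<Rightarrow> 'a set \<Rightarrow> (nat \<Rightarrow> 'a set) \<Rightarrow> nat \<Rightarrow> bool" where
  "fence X F G V n \<longleftrightarrow>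
     X closure_of F \<inter> X closure_of G = {} \<and> X frontier_of V n \<subseteq> G \<and>
     V n \<subseteq> V (Suc n) \<and> F \<inter> (V (Suc n) - V n) \<noteq> {}"

text \<open>
  Were there infinitely many fences, two of the points of \<open>F\<close> that they separate would lie in
  the same member of a finite cover by connected sets that miss \<open>F\<close> or \<open>G\<close>.
\<close>
lemma infinitely_many_fences_impossible:
  assumes compact: "compact_space X" and lconn: "locally_connected_space X"
    and FG: "F \<subseteq> topspace X" "G \<subseteq> topspace X"
    and fence: "\<And>n. fence X F G V n"
  shows False
proof -
  have "\<exists>U C. openin X U \<and> x \<in> U \<and> U \<subseteq> C \<and> connectedin X C \<and> (C \<inter> F = {} \<or> C \<inter> G = {})"
    if x: "x \<in> topspace X" for x
  proof -
    have cl: "F \<subseteq> X closure_of F" "G \<subseteq> X closure_of G"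
      using FG by (simp_all add: closure_of_subset)
    have "x \<notin> X closure_of F \<or> x \<notin> X closure_of G"
      using fence[of 0] unfolding fence_def by blast
    moreover have "openin X (topspace X - X closure_of S)" for S
      by (intro openin_diff openin_topspace closedin_closure_of)
    ultimately obtain D where D: "openin X D" "x \<in> D" "D \<inter> F = {} \<or> D \<inter> G = {}"
      using x cl by (metis Diff_iff Int_commute disjoint_iff subsetD)
    have "neighbourhood_base_of (connectedin X) X"
      using lconn by (simp add: locally_connected_space_def)
    from this[unfolded neighbourhood_base_of, rule_format, of D x] D(1,2)
    obtain U C where "openin X U" "x \<in> U" "U \<subseteq> C" "C \<subseteq> D" "connectedin X C"
      by auto
    with D show ?thesis by blast
  qed
  then obtain U C where UC: "\<And>x. x \<in> topspace X \<Longrightarrow> openin X (U x) \<and> x \<in> U x \<and> U x \<subseteq> C x \<and>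
      connectedin X (C x) \<and> (C x \<inter> F = {} \<or> C x \<inter> G = {})"
    by metis
  have "\<forall>S\<in>U ` topspace X. openin X S" "topspace X \<subseteq> \<Union>(U ` topspace X)"
    using UC by auto
  then obtain \<F> where \<F>: "finite \<F>" "\<F> \<subseteq> U ` topspace X" "topspace X \<subseteq> \<Union>\<F>"
    using compact unfolding compact_space_def compactin_def by meson
  from \<F>(1,2) obtain T where T: "finite T" "T \<subseteq> topspace X" "\<F> = U ` T"
    by (meson finite_subset_image)
  have "\<exists>p. p \<in> F \<and> p \<in> V (Suc n) - V n" for n
    using fence[of n] unfolding fence_def by blast
  then obtain p where p: "\<And>n. p n \<in> F" "\<And>n. p n \<in> V (Suc n)" "\<And>n. p n \<notin> V n"
    by (metis Diff_iff)
  have "\<exists>t. t \<in> T \<and> p n \<in> C t" for n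
  proof -
    have "p n \<in> \<Union>(U ` T)"
      using \<F>(3) T(3) p(1)[of n] FG(1) by blast
    then show ?thesis
      using UC T(2) by blast
  qed
  then obtain t where t: "\<And>n. t n \<in> T" "\<And>n. p n \<in> C (t n)"
    by metis
  have "\<not> inj t"
    using T(1) t(1) by (metis finite_subset finite_imageD image_subsetI infinite_UNIV_nat)
  then obtain m n where mn: "m < n" "t m = t n"
    by (metis injI linorder_neqE_nat)
  define K where "K = C (t n)"
  have K: "connectedin X K" "K \<inter> F = {} \<or> K \<inter> G = {}"
    using UC[of "t n"] t(1)[of n] T(2) unfolding K_def by blast+
  have "V k \<subseteq> V (Suc k)" for k
    using fence[of k] unfolding fence_def by blast
  then have "V (Suc m) \<subseteq> V n"
    using mn(1) by (metis Suc_leI lift_Suc_mono_le)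
  then have "p m \<in> K \<inter> V n" "p n \<in> K - V n"
    using t(2)[of m] t(2)[of n] mn(2) p(2)[of m] p(3)[of n] by (auto simp: K_def)
  then have "K \<inter> X frontier_of V n \<noteq> {}"
    using connectedin_Int_frontier_of[OF K(1), of "V n"] by blast
  then have "K \<inter> G \<noteq> {}"
    using fence[of n] unfolding fence_def by blast
  moreover have "K \<inter> F \<noteq> {}"
    using p(1)[of m] \<open>p m \<in> K \<inter> V n\<close> by blast
  ultimately show False
    using K(2) by blast
qed

text \<open>
  A new point is separated from the finite, hence compact, set of the old ones, and the old
  neighbourhoods are shrunk accordingly.
\<close>
lemma Hausdorff_space_separate_finite:
  assumes "Hausdorff_space X" "finite A" "A \<subseteq> topspace X"
  shows "\<exists>W. (\<forall>a\<in>A. openin X (W a) \<and> a \<in> W a) \<and> disjoint_family_on W A"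
  using assms(2,3)
proof (induction A rule: finite_induct)
  case empty
  then show ?case by (simp add: disjoint_family_on_def)
next
  case (insert a A)
  obtain W where W: "\<And>b. b \<in> A \<Longrightarrow> openin X (W b) \<and> b \<in> W b" "disjoint_family_on W A"
    using insert.IH insert.prems by (metis insert_subset)
  have "compactin X {a}" "compactin X A" "disjnt {a} A"
    using insert.hyps insert.prems by (simp_all add: finite_imp_compactin)
  then obtain S T where ST: "openin X S" "openin X T" "{a} \<subseteq> S" "A \<subseteq> T" "disjnt S T"
    by (rule Hausdorff_space_compact_separation[OF assms(1)])
  define W' where "W' = (\<lambda>b. if b = a then S else W b \<inter> T)"
  have "\<forall>b\<in>insert a A. openin X (W' b) \<and> b \<in> W' b"
    using W ST by (auto simp: W'_def)
  moreover have "disjoint_family_on W' (insert a A)"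
    using W(2) ST(5) by (auto simp: W'_def disjoint_family_on_def disjnt_def)
  ultimately show ?case by blast
qed

text \<open>
  The points of \<open>F\<close> are enclosed one at a time: \<open>V n\<close> is the union of the first \<open>n\<close> of the
  disjoint open sets, so its frontier avoids these because it is open, and the remaining ones
  because they are open and disjoint from it.
\<close>
lemma finitely_many_fences_exist:
  assumes haus: "Hausdorff_space X" and inf: "infinite (topspace X)"
  obtains F G V where "F \<subseteq> topspace X" "G \<subseteq> topspace X" "\<And>n. V n \<subseteq> topspace X"
    "\<And>n. n < N \<Longrightarrow> fence X F G V n"
proof -
  obtain A where A: "A \<subseteq> topspace X" "finite A" "card A = N"
    using infinite_arbitrarily_large[OF inf] by metis
  obtain W where W: "\<And>a. a \<in> A \<Longrightarrow> openin X (W a) \<and> a \<in> W a" "disjoint_family_on W A"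
    using Hausdorff_space_separate_finite[OF haus A(2,1)] by blast
  obtain a where a: "bij_betw a {..<N} A"
    using bij_betw_from_nat_into_finite[OF A(2)] A(3) by blast
  then have aA: "\<And>n. n < N \<Longrightarrow> a n \<in> A" and a_surj: "A = a ` {..<N}"
    and a_inj: "inj_on a {..<N}"
    by (auto simp: bij_betw_def)
  have disj: "W (a m) \<inter> W (a n) = {}" if "m < N" "n < N" "m \<noteq> n" for m n
    using W(2) aA a_inj that unfolding disjoint_family_on_def inj_on_def by blast
  define G where "G = topspace X - (\<Union>b\<in>A. W b)"
  \<comment> \<open>The points of \<open>A\<close> are the \<open>a i\<close> with \<open>i < N\<close>; from \<open>N\<close> on, \<open>V\<close> is constant.\<close>
  define V where "V = (\<lambda>n. \<Union>i\<in>{..<min n N}. W (a i))"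
  have V_disj: "V n \<inter> W (a i) = {}" if "n \<le> i" "i < N" for n i
  proof -
    have "W (a j) \<inter> W (a i) = {}" if "j < min n N" for j
      using disj[of j i] that \<open>n \<le> i\<close> \<open>i < N\<close> by simp
    then show ?thesis
      unfolding V_def by blast
  qed
  have openV: "openin X (V n)" for n
    unfolding V_def using W(1) aA by auto
  have closG: "closedin X G"
    unfolding G_def using W(1) by (intro closedin_diff) auto
  have closA: "closedin X A"
    by (metis A(1,2) Hausdorff_imp_t1_space haus t1_space_closedin_finite)
  have fence: "fence X A G V n" if "n < N" for n
    unfolding fence_def
  proof (intro conjI)
    show "X closure_of A \<inter> X closure_of G = {}"
      unfolding closure_of_closedin[OF closA] closure_of_closedin[OF closG]
      using W(1) by (auto simp: G_def)
    show "X frontier_of V n \<subseteq> G"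
    proof
      fix x assume x: "x \<in> X frontier_of V n"
      then have x': "x \<in> X closure_of V n" "x \<notin> V n" "x \<in> topspace X"
        using openV[of n]
        by (auto simp: frontier_of_def interior_of_openin in_closure_of)
      have "x \<notin> W (a i)" if "i < N" for i
      proof
        assume xi: "x \<in> W (a i)"
        with x'(2) that \<open>n < N\<close> have "n \<le> i"
          unfolding V_def by force
        then show False
          using V_disj[OF _ that] x'(1) xi W(1)[OF aA[OF that]] unfolding in_closure_of by blast
      qed
      then show "x \<in> G"
        using x'(3) by (auto simp: G_def a_surj)
    qed
    show "V n \<subseteq> V (Suc n)"
      by (force simp: V_def)
    have "a n \<in> V (Suc n)"
      using that W(1)[OF aA[OF that]] by (auto simp: V_def)
    moreover have "a n \<notin> V n"
      using V_disj[of n n] that W(1)[OF aA[OF that]] by blast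
    ultimately show "A \<inter> (V (Suc n) - V n) \<noteq> {}"
      using aA[OF that] by blast
  qed
  show thesis
  proof (rule that[OF A(1)])
    show "G \<subseteq> topspace X" "\<And>n. V n \<subseteq> topspace X"
      using closedin_subset[OF closG] openin_subset[OF openV] by auto
  qed (fact fence)
qed

section \<open>Describing fences by formulas\<close>

text \<open>
  The parameter \<open>I\<close> is the interior operator of the language at hand: \<open>Box\<close> or, where only
  the derivative operator is available, \<open>\<lambda>\<phi>. And \<phi> (DBox \<phi>)\<close>.  The atoms \<open>e 0\<close>, \<open>e 1\<close> and
  \<open>e (n + 2)\<close> stand for \<open>F\<close>, \<open>G\<close> and \<open>V n\<close>.
\<close>
definition fence_fm :: "('v fm \<Rightarrow> 'v fm) \<Rightarrow> (nat \<Rightarrow> 'v) \<Rightarrow> nat \<Rightarrow> 'v fm" where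
  "fence_fm I e n =
     (let f = Atom (e 0); g = Atom (e 1); v = Atom (e (n + 2)); v' = Atom (e (n + 3)) in
      And (And (All (Neg (And (Neg (I (Neg f))) (Neg (I (Neg g))))))
               (All (Neg (And (Neg g) (And (Neg (I v)) (Neg (I (Neg v))))))))
          (And (All (Neg (And v (Neg v'))))
               (Neg (All (Neg (And f (And v' (Neg v))))))))"

lemma sat_fence_fm:
  assumes h: "assignment X h"
    and I: "\<And>\<phi> x. x \<in> topspace X \<Longrightarrow> sat X h x (I \<phi>) \<longleftrightarrow> sat X h x (Box \<phi>)"
  shows "sat X h x (fence_fm I e n) \<longleftrightarrow> fence X (h (e 0)) (h (e 1)) (\<lambda>n. h (e (n + 2))) n"
proof -
  have top: "h p \<subseteq> topspace X" for p
    using h by (simp add: assignment_def)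
  have box_neg: "sat X h y (I (Neg (Atom p))) \<longleftrightarrow> y \<notin> X closure_of h p"
    if "y \<in> topspace X" for y p
    using that I[OF that] by (auto simp: in_closure_of)
  have box: "sat X h y (I (Atom p)) \<longleftrightarrow> y \<in> X interior_of h p" if "y \<in> topspace X" for y p
    using I[OF that] by (auto simp: interior_of_def)
  have cl: "X closure_of S \<subseteq> topspace X" for S
    by (rule closure_of_subset_topspace)
  have "e (n + 3) = e (Suc n + 2)"
    by (simp add: numeral_eq_Suc)
  then show ?thesis
    unfolding fence_fm_def fence_def Let_def frontier_of_def
    using top[of "e 0"] top[of "e 1"] top[of "e (n + 2)"] top[of "e (n + 3)"]
      cl[of "h (e 0)"] cl[of "h (e 1)"] cl[of "h (e (n + 2))"]
    by (simp add: box box_neg cong: ball_cong) blast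
qed

lemma finitely_many_fence_fms_satisfiable:
  assumes "Hausdorff_space X" "infinite (topspace X)" "inj e"
    and I: "\<And>h \<phi> x. x \<in> topspace X \<Longrightarrow> sat X h x (I \<phi>) \<longleftrightarrow> sat X h x (Box \<phi>)"
    and A: "finite A" "A \<subseteq> range (fence_fm I e)"
  shows "satisfiable_in X A"
proof -
  from A obtain M where M: "finite M" "A = fence_fm I e ` M"
    by (meson finite_subset_image)
  obtain N where N: "\<And>n. n \<in> M \<Longrightarrow> n < N"
    using M(1) unfolding finite_nat_set_iff_bounded by blast
  obtain F G V where FGV: "F \<subseteq> topspace X" "G \<subseteq> topspace X" "\<And>n. V n \<subseteq> topspace X"
    and fence: "\<And>n. n < N \<Longrightarrow> fence X F G V n"
    using finitely_many_fences_exist[OF assms(1,2)] by metis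
  define h where "h p = (case inv e p of 0 \<Rightarrow> F | Suc 0 \<Rightarrow> G | Suc (Suc n) \<Rightarrow> V n)" for p
  have h: "assignment X h"
    using FGV by (auto simp: assignment_def h_def split: nat.splits)
  have "h (e 0) = F" "h (e 1) = G" "\<And>n. h (e (n + 2)) = V n"
    using assms(3) by (auto simp: h_def)
  then have "\<forall>x. \<forall>\<phi>\<in>A. sat X h x \<phi>"
    using sat_fence_fm[OF h I, of _ e] fence N M(2) by auto
  moreover have "topspace X \<noteq> {}"
    using assms(2) by auto
  ultimately show ?thesis
    unfolding satisfiable_in_def using h by blast
qed

lemma fence_fms_not_satisfiable:
  assumes "compact_space X" "locally_connected_space X"
    and I: "\<And>h \<phi> x. x \<in> topspace X \<Longrightarrow> sat X h x (I \<phi>) \<longleftrightarrow> sat X h x (Box \<phi>)"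
  shows "\<not> satisfiable_in X (range (fence_fm I e))"
proof
  assume "satisfiable_in X (range (fence_fm I e))"
  then obtain h x where h: "assignment X h" "\<And>n. sat X h x (fence_fm I e n)"
    unfolding satisfiable_in_def by auto
  then have "fence X (h (e 0)) (h (e 1)) (\<lambda>n. h (e (n + 2))) n" for n
    using sat_fence_fm[OF h(1) I] by blast
  moreover have "h p \<subseteq> topspace X" for p
    using h(1) by (simp add: assignment_def)
  ultimately show False
    using infinitely_many_fences_impossible[OF assms(1,2),
        of "h (e 0)" "h (e 1)" "\<lambda>n. h (e (n + 2))"] by blast
qed

section \<open>Strong completeness and compactness\<close>

lemma sat_conjunction_of:
  "conjunction_of A \<phi> \<Longrightarrow> sat X h x \<phi> \<longleftrightarrow> (\<forall>\<psi>\<in>A. sat X h x \<psi>)"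
  by (induction rule: conjunction_of.induct) auto

text \<open>
  By soundness the negation of a conjunction of jointly satisfiable formulas is not a theorem,
  so finite satisfiability implies consistency.
\<close>
lemma sound_and_strongly_complete_imp_compact:
  assumes "sound_over L H X" "strongly_complete_over L H X" "\<Gamma> \<subseteq> L" "countable \<Gamma>"
    and fin: "\<And>A. finite A \<Longrightarrow> A \<subseteq> \<Gamma> \<Longrightarrow> satisfiable_in X A"
  shows "satisfiable_in X \<Gamma>"
proof -
  have "consistent L H \<phi>" if "finite A" "A \<subseteq> \<Gamma>" "conjunction_of A \<phi>" for A \<phi>
  proof -
    have "\<not> valid_in X (Neg \<phi>)"
      using fin[OF that(1,2)]
      unfolding satisfiable_in_def valid_in_def sat_conjunction_of[OF that(3), symmetric] by auto
    then show ?thesis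
      using assms(1) unfolding consistent_def sound_over_def by blast
  qed
  then have "consistent_set L H \<Gamma>"
    unfolding consistent_set_def by blast
  then show ?thesis
    using assms(2-4) unfolding strongly_complete_over_def by blast
qed

lemma infinite_dense_in_itself:
  assumes "t1_space X" "dense_in_itself X" "topspace X \<noteq> {}"
  shows "infinite (topspace X)"
proof
  assume "finite (topspace X)"
  then have "X = discrete_topology (topspace X)"
    using assms(1) finite_t1_space_imp_discrete_topology by blast
  then have "openin X {x}" if "x \<in> topspace X" for x
    using that by (metis empty_subsetI insert_subset openin_discrete_topology)
  then show False
    using assms(2,3) unfolding dense_in_itself_def by blast
qed

theorem corollary10p5:
  fixes X :: "'a metric" and L :: "'v fm set" and Ops :: "operator set"
  assumes "infinite (UNIV :: 'v set)"
    and "mspace X \<noteq> {}"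
    and "compact_space (mtopology_of X)"
    and "locally_connected_space (mtopology_of X)"
    and "dense_in_itself (mtopology_of X)"
    and "L = language Ops"
    and "language {OBox, OAll} \<subseteq> L \<or> language {ODBox, OAll} \<subseteq> L"
  shows "\<not> (\<exists>H. hilbert_system L H \<and> sound_over L H (mtopology_of X)
              \<and> strongly_complete_over L H (mtopology_of X))"
proof -
  let ?X = "mtopology_of X"
  have haus: "Hausdorff_space ?X"
    unfolding mtopology_of_def
    by (rule Metric_space.Hausdorff_space_mtopology[OF Metric_space_mspace_mdist])
  have inf: "infinite (topspace ?X)"
    using assms(2,5) haus
    by (intro infinite_dense_in_itself) (auto intro: Hausdorff_imp_t1_space)
  obtain e :: "nat \<Rightarrow> 'v" where e: "inj e"
    using infinite_countable_subset[OF assms(1)] by blast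
  obtain I :: "'v fm \<Rightarrow> 'v fm" where I_L: "range (fence_fm I e) \<subseteq> L"
    and I: "\<And>h \<phi> x. sat ?X h x (I \<phi>) \<longleftrightarrow> sat ?X h x (Box \<phi>)"
    using assms(7)
  proof
    assume "language {OBox, OAll} \<subseteq> L"
    moreover have "range (fence_fm Box e) \<subseteq> language {OBox, OAll}"
      by (auto simp: fence_fm_def Let_def language_def)
    ultimately show thesis
      using that[of Box] by auto
  next
    assume "language {ODBox, OAll} \<subseteq> L"
    moreover have "range (fence_fm (\<lambda>\<phi>. And \<phi> (DBox \<phi>)) e) \<subseteq> language {ODBox, OAll}"
      by (auto simp: fence_fm_def Let_def language_def)
    moreover have "sat ?X h x (And \<phi> (DBox \<phi>)) \<longleftrightarrow> sat ?X h x (Box \<phi>)" for h x \<phi>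
      by auto
    ultimately show thesis
      using that[of "\<lambda>\<phi>. And \<phi> (DBox \<phi>)"] by blast
  qed
  have "countable (range (fence_fm I e))"
    by simp
  then show ?thesis
    using sound_and_strongly_complete_imp_compact[OF _ _ I_L]
      finitely_many_fence_fms_satisfiable[OF haus inf e I]
      fence_fms_not_satisfiable[OF assms(3,4) I, of e]
    by blast
qed

end
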